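(* Let $\mathcal{P}$ be a partition of the scenario set $S$ with $|\mathcal{P}|>\lfloor\tau|S|\rfloor$, and let $\underline{x}$ be the optimal solution of the partitioned model $\mathrm{L}(\mathcal{P})$. Let $\mathcal{R}$ be a refinement of $\mathcal{P}$ constructed by applying the Minimal Size Refinement algorithm to $(S,\mathcal{P},\underline{x})$, and suppose that $$\min_{R\in\mathcal{R}\setminus\mathcal{P}}\rho_R>v^{L}(\mathcal{P}).$$ If $\underline{x}$ is the unique optimal solution of $\mathrm{L}(\mathcal{P})$ and is infeasible for the original problem, then any merger $\mathcal{M}$ of $\mathcal{R}$ obtained by applying the Maximal Size Merger algorithm to $(S,\mathcal{P},\mathcal{R},\underline{x})$ satisfies $|\mathcal{M}|=|\mathcal{P}|$ and $$v^{L}(\mathcal{M})>v^{L}(\mathcal{P}).$$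
   Context: Setting. $S$ is a finite nonempty set of scenarios, $\tau\in[0,1]$, $\mathcal{X}\subseteq\mathbb{R}^n$, $f:\mathcal{X}\to\mathbb{R}$, and for each $s\in S$ a set $X^s\subseteq\mathbb{R}^n$ is given. All scenarios are equiprobable: $p_s=1/|S|$ for all $s\in S$. Original problem: $v^*=\min\{f(x): x\in\mathcal{X},\ \sum_{s\in S}p_s\mathbf{1}(x\in X^s)\ge 1-\tau\}$. A point $x\in\mathcal X$ is feasible (infeasible) for it if the inequality holds (fails). A partition $\mathcal{P}$ of $S$ is a collection of non-empty, pairwise disjoint subsets of $S$ whose union is $S$. For $P\subseteq S$ put $X^P=\bigcap_{s\in P}X^s$, and for $x\in\mathcal X$ put $z_P(x)=\mathbf{1}(x\in X^P)$. Partitioned model $\mathrm{L}(\mathcal{P})$: $v^{L}(\mathcal{P})=\min\{f(x): x\in\mathcal{X},\ \sum_{P\in\mathcal{P}}q_P z_P(x)\ge\sum_{P\in\mathcal{P}}q_P-\tau\}$ with $q_P=\min_{s\in P}p_s$. Under equiprobability the constraint is equivalent to $\sum_{P\in\mathcal{P}}z_P(x)\ge|\mathcal{P}|-\lfloor\tau|S|\rfloor$. For nonempty $P\subseteq S$, the subset cost is $\rho_P=\min\{f(x): x\in X^P\cap\mathcal{X}\}$. A minimization problem is assumed to attain its minimum whenever it is feasible, and has value $+\infty$ if it is infeasible. A partition $\mathcal{R}$ of $S$ is a refinement of $\mathcal{P}$ if for every $R\in\mathcal{R}$ there is $P\in\mathcal{P}$ with $R\subseteq P$. A partition $\mathcal{M}$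 of $S$ is a merger of $\mathcal{R}$ if for every $R\in\mathcal{R}$ there is $M\in\mathcal{M}$ with $R\subseteq M$. For $x\in\mathcal{X}$ and a partition $\mathcal A$ of $S$: $\mathcal{A}_F(x)=\{A\in\mathcal{A}: x\in X^A\}$, $\mathcal{A}_I(x)=\{A\in\mathcal{A}: x\notin X^A\}$, and $S_I(x)=\{s\in S: x\notin X^s\}$. Minimal Size Refinement algorithm. Input: $S$, a partition $\mathcal{P}$ of $S$, a point $\underline{x}\in\mathcal{X}$. Initialize $\mathcal{R}\leftarrow\mathcal{P}$ and $\mu\leftarrow\lfloor\tau|S|\rfloor+1-|\mathcal{P}_I(\underline{x})|$. While $|\mathcal{R}|<|\mathcal{P}|+\mu$: select $R_1\in\mathcal{R}_I(\underline{x})$ with $|R_1\cap S_I(\underline{x})|\ge2$; select two distinct scenarios $s_1,s_2\in R_1\cap S_I(\underline{x})$; set $R_{\text{left}}=\{s_1\}$, $R_{\text{right}}=\{s_2\}$; allocate each remaining scenario of $R_1\setminus\{s_1,s_2\}$ to exactly one of $R_{\text{left}}$, $R_{\text{right}}$ (arbitrarily); replace $R_1$ in $\mathcal{R}$ by the two sets $R_{\text{left}},R_{\text{right}}$. Return $\mathcal{R}$. Maximal Size Merger algorithm. Input: $S$, a partition $\mathcal{P}$ of $S$, a refinement $\mathcal{R}$ of $\mathcal{P}$, a point $\underline{x}\in\mathcal{X}$. Initialize $\mathcal{M}\leftarrow\mathcal{R}$ and $\mu\leftarrow\lfloor\tau|S|\rfloor+1-|\mathcal{P}_I(\underline{x})|$.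 If $|\mathcal{P}|=\lfloor\tau|S|\rfloor+1$, select $\mu$ distinct sets $M_1,\dots,M_\mu\in\mathcal{M}_F(\underline{x})$ and one set $M_{\mu+1}\in\mathcal{M}_I(\underline{x})$; otherwise select $\mu+1$ distinct sets $M_1,\dots,M_{\mu+1}\in\mathcal{M}_F(\underline{x})$. Replace $M_1,\dots,M_{\mu+1}$ in $\mathcal{M}$ by the single set $M_{\mu+2}=\bigcup_{i=1}^{\mu+1}M_i$. Return $\mathcal{M}$. (All selections in both algorithms are arbitrary.) *)

theory Defs
  imports "HOL-Analysis.Analysis" "HOL-Library.Disjoint_Sets"
begin

text \<open>A minimization problem is given by an objective \<open>f\<close> and a feasible set \<open>F\<close>; its optimal
  solutions are the \<open>x\<close> with \<open>is_arg_min f (\<lambda>y. y \<in> F) x\<close>. Its value is the minimum whenever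
  \<open>attains_min\<close> holds and \<open>F\<close> is nonempty, and \<open>\<infinity>\<close> if \<open>F\<close> is empty.\<close>

definition opt_value :: "('x \<Rightarrow> real) \<Rightarrow> 'x set \<Rightarrow> ereal" where
  "opt_value f F = (INF x\<in>F. ereal (f x))"

definition attains_min :: "('x \<Rightarrow> real) \<Rightarrow> 'x set \<Rightarrow> bool" where
  "attains_min f F \<longleftrightarrow> (F \<noteq> {} \<longrightarrow> (\<exists>x. is_arg_min f (\<lambda>y. y \<in> F) x))"

text \<open>Throughout, \<open>D\<close> is the deterministic feasible region, \<open>Xs s\<close> the set belonging to
  scenario \<open>s\<close>, and \<open>p s\<close> the probability of \<open>s\<close>.\<close>

definition original_feasible ::
  "'s set \<Rightarrow> ('s \<Rightarrow> real) \<Rightarrow> real \<Rightarrow> 'x set \<Rightarrow> ('s \<Rightarrow> 'x set) \<Rightarrow> 'x set" where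
  "original_feasible S p \<tau> D Xs = {x \<in> D. (\<Sum>s\<in>S. p s * indicator (Xs s) x) \<ge> 1 - \<tau>}"

definition scenario_Inter :: "('s \<Rightarrow> 'x set) \<Rightarrow> 's set \<Rightarrow> 'x set" where
  "scenario_Inter Xs P = (\<Inter>s\<in>P. Xs s)"

definition subset_prob :: "('s \<Rightarrow> real) \<Rightarrow> 's set \<Rightarrow> real" where
  "subset_prob p P = Min (p ` P)"

definition partitioned_feasible ::
  "('s \<Rightarrow> real) \<Rightarrow> real \<Rightarrow> 'x set \<Rightarrow> ('s \<Rightarrow> 'x set) \<Rightarrow> 's set set \<Rightarrow> 'x set" where
  "partitioned_feasible p \<tau> D Xs \<P> =
     {x \<in> D. (\<Sum>P\<in>\<P>. subset_prob p P * indicator (scenario_Inter Xs P) x)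
              \<ge> (\<Sum>P\<in>\<P>. subset_prob p P) - \<tau>}"

definition partitioned_value ::
  "('s \<Rightarrow> real) \<Rightarrow> real \<Rightarrow> 'x set \<Rightarrow> ('x \<Rightarrow> real) \<Rightarrow> ('s \<Rightarrow> 'x set) \<Rightarrow> 's set set \<Rightarrow> ereal" where
  "partitioned_value p \<tau> D f Xs \<P> = opt_value f (partitioned_feasible p \<tau> D Xs \<P>)"

definition subset_cost ::
  "'x set \<Rightarrow> ('x \<Rightarrow> real) \<Rightarrow> ('s \<Rightarrow> 'x set) \<Rightarrow> 's set \<Rightarrow> ereal" where
  "subset_cost D f Xs P = opt_value f (scenario_Inter Xs P \<inter> D)"

definition feasible_subsets :: "('s \<Rightarrow> 'x set) \<Rightarrow> 's set set \<Rightarrow> 'x \<Rightarrow> 's set set" where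
  "feasible_subsets Xs \<A> x = {A \<in> \<A>. x \<in> scenario_Inter Xs A}"

definition infeasible_subsets :: "('s \<Rightarrow> 'x set) \<Rightarrow> 's set set \<Rightarrow> 'x \<Rightarrow> 's set set" where
  "infeasible_subsets Xs \<A> x = {A \<in> \<A>. x \<notin> scenario_Inter Xs A}"

definition infeasible_scenarios :: "'s set \<Rightarrow> ('s \<Rightarrow> 'x set) \<Rightarrow> 'x \<Rightarrow> 's set" where
  "infeasible_scenarios S Xs x = {s \<in> S. x \<notin> Xs s}"

text \<open>The number \<open>\<mu>\<close> of both algorithms. It is an integer since the difference could be negative
  for an arbitrary point \<open>x\<close>.\<close>

definition refine_count ::
  "'s set \<Rightarrow> real \<Rightarrow> ('s \<Rightarrow> 'x set) \<Rightarrow> 's set set \<Rightarrow> 'x \<Rightarrow> int" where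
  "refine_count S \<tau> Xs \<P> x =
     \<lfloor>\<tau> * real (card S)\<rfloor> + 1 - int (card (infeasible_subsets Xs \<P> x))"

text \<open>Both algorithms make arbitrary selections, so they are relations between input and output:
  one pass through the loop body, then the while loop, then the full refinement algorithm. A run
  that cannot make a required selection returns nothing.\<close>

definition refinement_step ::
  "'s set \<Rightarrow> ('s \<Rightarrow> 'x set) \<Rightarrow> 'x \<Rightarrow> 's set set \<Rightarrow> 's set set \<Rightarrow> bool" where
  "refinement_step S Xs x \<R> \<R>' \<longleftrightarrow>
     (\<exists>R1 \<in> infeasible_subsets Xs \<R> x. card (R1 \<inter> infeasible_scenarios S Xs x) \<ge> 2 \<and>
        (\<exists>s1 \<in> R1 \<inter> infeasible_scenarios S Xs x. \<exists>s2 \<in> R1 \<inter> infeasible_scenarios S Xs x.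
           s1 \<noteq> s2 \<and>
           (\<exists>Rleft Rright. s1 \<in> Rleft \<and> s2 \<in> Rright \<and>
              Rleft \<union> Rright = R1 \<and> Rleft \<inter> Rright = {} \<and>
              \<R>' = (\<R> - {R1}) \<union> {Rleft, Rright})))"

inductive refinement_loop ::
  "'s set \<Rightarrow> ('s \<Rightarrow> 'x set) \<Rightarrow> 'x \<Rightarrow> int \<Rightarrow> 's set set \<Rightarrow> 's set set \<Rightarrow> bool"
  for S :: "'s set" and Xs :: "'s \<Rightarrow> 'x set" and x :: 'x and N :: int where
  exit: "\<not> int (card \<R>) < N \<Longrightarrow> refinement_loop S Xs x N \<R> \<R>"
| iterate: "int (card \<R>) < N \<Longrightarrow> refinement_step S Xs x \<R> \<R>' \<Longrightarrow>
    refinement_loop S Xs x N \<R>' \<R>'' \<Longrightarrow> refinement_loop S Xs x N \<R> \<R>''"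

definition minimal_size_refinement ::
  "'s set \<Rightarrow> real \<Rightarrow> ('s \<Rightarrow> 'x set) \<Rightarrow> 's set set \<Rightarrow> 'x \<Rightarrow> 's set set \<Rightarrow> bool" where
  "minimal_size_refinement S \<tau> Xs \<P> x \<R> \<longleftrightarrow>
     refinement_loop S Xs x (int (card \<P>) + refine_count S \<tau> Xs \<P> x) \<P> \<R>"

text \<open>\<open>\<T>\<close> collects the distinct sets that get merged.\<close>

definition maximal_size_merger ::
  "'s set \<Rightarrow> real \<Rightarrow> ('s \<Rightarrow> 'x set) \<Rightarrow> 's set set \<Rightarrow> 's set set \<Rightarrow> 'x \<Rightarrow> 's set set \<Rightarrow> bool" where
  "maximal_size_merger S \<tau> Xs \<P> \<R> x \<M> \<longleftrightarrow>
     (\<exists>\<T>. (if int (card \<P>) = \<lfloor>\<tau> * real (card S)\<rfloor> + 1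
            then \<exists>\<F> M. \<F> \<subseteq> feasible_subsets Xs \<R> x \<and>
                   int (card \<F>) = refine_count S \<tau> Xs \<P> x \<and>
                   M \<in> infeasible_subsets Xs \<R> x \<and> \<T> = insert M \<F>
            else \<T> \<subseteq> feasible_subsets Xs \<R> x \<and>
                   int (card \<T>) = refine_count S \<tau> Xs \<P> x + 1) \<and>
          \<M> = insert (\<Union>\<T>) (\<R> - \<T>))"

text \<open>The outputs are a refinement of \<open>\<P>\<close> and a merger of \<open>\<R>\<close>, in the sense of \<^const>\<open>refines\<close>.\<close>

lemma refinement_step_refines:
  assumes "partition_on S \<R>" and "refinement_step S Xs x \<R> \<R>'"
  shows "refines S \<R>' \<R>"
proof -
  obtain R1 s1 s2 Rl Rr where R1: "R1 \<in> \<R>" and s: "s1 \<in> Rl" "s2 \<in> Rr"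
    and un: "Rl \<union> Rr = R1" and dis: "Rl \<inter> Rr = {}" and R': "\<R>' = (\<R> - {R1}) \<union> {Rl, Rr}"
    using assms(2) unfolding refinement_step_def infeasible_subsets_def by blast
  have U: "\<Union>\<R> = S" and D: "\<And>A B. A \<in> \<R> \<Longrightarrow> B \<in> \<R> \<Longrightarrow> A \<noteq> B \<Longrightarrow> A \<inter> B = {}" and E: "{} \<notin> \<R>"
    using assms(1) by (auto simp: partition_on_def disjoint_def)
  have "\<Union>\<R>' = S" using U R1 un R' by auto
  moreover have "A \<inter> B = {}" if "A \<in> \<R>'" "B \<in> \<R>'" "A \<noteq> B" for A B
  proof -
    have "A \<inter> Rl = {} \<and> A \<inter> Rr = {}" if "A \<in> \<R> - {R1}" for A
      using D[of A R1] that R1 un by blast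
    then show ?thesis using that(1-3) D dis unfolding R' by (metis Int_commute Un_iff insert_iff singletonD Diff_iff empty_iff)
  qed
  moreover have "{} \<notin> \<R>'" using E s R' by auto
  ultimately have "partition_on S \<R>'" by (auto simp: partition_on_def disjoint_def)
  then show ?thesis using assms(1) R1 un R' by (auto simp: refines_def)
qed

lemma minimal_size_refinement_refines:
  assumes "partition_on S \<P>" and "minimal_size_refinement S \<tau> Xs \<P> x \<R>"
  shows "refines S \<R> \<P>"
proof -
  have "refines S \<R>' \<A>" if "refinement_loop S Xs x N \<A> \<R>'" "partition_on S \<A>" for N \<A> \<R>'
    using that
  proof (induction rule: refinement_loop.induct)
    case (exit \<R>)
    then show ?case by (auto simp: refines_def)
  next
    case (iterate \<R> \<R>' \<R>'')
    then have "refines S \<R>' \<R>" by (blast intro: refinement_step_refines)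
    with iterate show ?case by (meson refines_def refines_trans)
  qed
  then show ?thesis using assms unfolding minimal_size_refinement_def by blast
qed

lemma maximal_size_merger_refines:
  assumes "partition_on S \<R>" and "maximal_size_merger S \<tau> Xs \<P> \<R> x \<M>"
    and "refine_count S \<tau> Xs \<P> x \<ge> 0"
  shows "refines S \<R> \<M>"
proof -
  obtain \<T> where sel: "if int (card \<P>) = \<lfloor>\<tau> * real (card S)\<rfloor> + 1
            then \<exists>\<F> M. \<F> \<subseteq> feasible_subsets Xs \<R> x \<and>
                   int (card \<F>) = refine_count S \<tau> Xs \<P> x \<and>
                   M \<in> infeasible_subsets Xs \<R> x \<and> \<T> = insert M \<F>
            else \<T> \<subseteq> feasible_subsets Xs \<R> x \<and>
                   int (card \<T>) = refine_count S \<tau> Xs \<P> x + 1"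
    and M: "\<M> = insert (\<Union>\<T>) (\<R> - \<T>)"
    using assms(2) unfolding maximal_size_merger_def by (elim exE conjE)
  have T: "\<T> \<subseteq> \<R>" "\<T> \<noteq> {}"
    using sel assms(3) unfolding feasible_subsets_def infeasible_subsets_def
    by (cases "int (card \<P>) = \<lfloor>\<tau> * real (card S)\<rfloor> + 1"; force)+
  have U: "\<Union>\<R> = S" and D: "\<And>A B. A \<in> \<R> \<Longrightarrow> B \<in> \<R> \<Longrightarrow> A \<noteq> B \<Longrightarrow> A \<inter> B = {}" and E: "{} \<notin> \<R>"
    using assms(1) by (auto simp: partition_on_def disjoint_def)
  have "\<Union>\<M> = S" using U T M by auto
  moreover have "A \<inter> B = {}" if "A \<in> \<M>" "B \<in> \<M>" "A \<noteq> B" for A B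
  proof -
    have "A \<inter> \<Union>\<T> = {}" if "A \<in> \<R> - \<T>" for A
      using D[of A] that T by blast
    then show ?thesis using that(1-3) D unfolding M by (metis Int_commute insert_iff Diff_iff)
  qed
  moreover have "{} \<notin> \<M>"
  proof -
    have "\<Union>\<T> \<noteq> {}" using T E by (metis Union_empty_conv ex_in_conv subsetD)
    then show ?thesis using E M by auto
  qed
  ultimately have "partition_on S \<M>" by (auto simp: partition_on_def disjoint_def)
  then show ?thesis using assms(1) M by (auto simp: refines_def)
qed

end

theory Submission
  imports Defs
begin

text \<open>With equal probabilities, feasibility in a partitioned model only depends on the number of
  parts a point violates: this number may not exceed \<open>K = \<lfloor>\<tau> |S|\<rfloor>\<close>
  (\<open>mem_partitioned_feasible_iff\<close>). The proof follows this number from \<open>\<P>\<close> through the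
  refinement \<open>\<R>\<close> to the merger \<open>\<M>\<close>.

  Each pass of the refinement splits a violated part of \<open>x\<close> into two parts that \<open>x\<close> violates
  again, so \<open>\<mu>\<close> passes bring the number of parts to \<open>|\<P>| + \<mu>\<close> and the number of parts violated
  by \<open>x\<close> to exactly \<open>K + 1\<close> (\<open>refinement_loop_card\<close>). The merger joins \<open>\<mu> + 1\<close> parts into one.
  This restores \<open>|\<M>| = |\<P>|\<close>, and since \<open>x\<close> violates at most one of the joined parts, \<open>x\<close> still
  violates \<open>K + 1\<close> parts of \<open>\<M>\<close>, so it is cut off.

  Let \<open>y\<close> be feasible for \<open>\<M>\<close>. If \<open>y\<close> satisfies some new part \<open>R \<in> \<R> - \<P>\<close>, its objective value
  is at least the cost of \<open>R\<close>, which exceeds the value of \<open>\<P>\<close>. If \<open>y\<close> violates all new parts,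
  then it violates at least \<open>\<mu>\<close> fewer parts of \<open>\<P>\<close> than of \<open>\<R>\<close>
  (\<open>card_infeasible_subsets_coarse_le\<close>), while undoing the merger raises the number of violated
  parts by at most \<open>\<mu>\<close>; hence \<open>y\<close> is feasible for \<open>\<P>\<close>. As \<open>y \<noteq> x\<close> and \<open>x\<close> is the only optimal
  solution for \<open>\<P>\<close>, the objective value of \<open>y\<close> is again larger. Since the minimum for \<open>\<M>\<close> is
  attained, the strict inequality passes to the optimal values.\<close>

section \<open>Feasibility as a count of violated parts\<close>

lemma finite_partition:
  assumes "finite S" "partition_on S \<A>"
  shows "finite \<A>"
  using assms by (metis finite_UnionD partition_onD1)

lemma mem_partitioned_feasible_iff:
  assumes "finite S" "S \<noteq> {}" and p: "\<And>s. s \<in> S \<Longrightarrow> p s = 1 / real (card S)"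
    and \<A>: "partition_on S \<A>"
  shows "y \<in> partitioned_feasible p \<tau> D Xs \<A> \<longleftrightarrow>
    y \<in> D \<and> int (card (infeasible_subsets Xs \<A> y)) \<le> \<lfloor>\<tau> * real (card S)\<rfloor>"
proof -
  let ?n = "real (card S)" and ?I = "infeasible_subsets Xs \<A> y"
  have n: "?n > 0" using assms(1,2) by (simp add: card_gt_0_iff)
  have fin: "finite \<A>" using assms(1) \<A> by (rule finite_partition)
  have q: "subset_prob p P = 1 / ?n" if "P \<in> \<A>" for P
  proof -
    have "P \<noteq> {}" "P \<subseteq> S" using that \<A> by (auto simp: partition_on_def)
    then have "p ` P = {1 / ?n}" using p by force
    then show ?thesis by (simp add: subset_prob_def)
  qed
  have "(\<Sum>P\<in>\<A>. subset_prob p P)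
      - (\<Sum>P\<in>\<A>. subset_prob p P * indicator (scenario_Inter Xs P) y)
    = (\<Sum>P\<in>\<A>. if y \<notin> scenario_Inter Xs P then 1 / ?n else 0)"
    unfolding sum_subtractf[symmetric]
    by (rule sum.cong) (auto simp: q indicator_def)
  also have "\<dots> = real (card ?I) / ?n"
    using fin by (simp add: infeasible_subsets_def flip: sum.inter_filter)
  finally have "(\<Sum>P\<in>\<A>. subset_prob p P * indicator (scenario_Inter Xs P) y)
      \<ge> (\<Sum>P\<in>\<A>. subset_prob p P) - \<tau> \<longleftrightarrow> real (card ?I) / ?n \<le> \<tau>"
    by linarith
  also have "\<dots> \<longleftrightarrow> int (card ?I) \<le> \<lfloor>\<tau> * ?n\<rfloor>"
    using n by (simp add: le_floor_iff field_simps)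
  finally show ?thesis by (simp add: partitioned_feasible_def)
qed

section \<open>Counting along the refinement\<close>

text \<open>Both halves of the split part contain a scenario that \<open>x\<close> violates, so the split adds one
  to the number of violated parts as well as to the number of all parts.\<close>

lemma refinement_step_card:
  assumes "finite S" and \<R>: "partition_on S \<R>" and "refinement_step S Xs x \<R> \<R>'"
  shows "card \<R>' = card \<R> + 1"
    and "card (infeasible_subsets Xs \<R>' x) = card (infeasible_subsets Xs \<R> x) + 1"
proof -
  obtain R1 s1 s2 Rl Rr where R1: "R1 \<in> infeasible_subsets Xs \<R> x"
    and x: "x \<notin> Xs s1" "x \<notin> Xs s2" and s: "s1 \<in> Rl" "s2 \<in> Rr"
    and un: "Rl \<union> Rr = R1" and dis: "Rl \<inter> Rr = {}" and R': "\<R>' = (\<R> - {R1}) \<union> {Rl, Rr}"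
    using assms(3) unfolding refinement_step_def infeasible_scenarios_def by blast
  have R1': "R1 \<in> \<R>" using R1 by (simp add: infeasible_subsets_def)
  have fin: "finite \<R>" using assms(1) \<R> by (rule finite_partition)
  have disj: "A \<inter> R1 = {}" if "A \<in> \<R>" "A \<noteq> R1" for A
    using \<R> R1' that by (auto simp: partition_on_def disjoint_def)
  have new: "Rl \<notin> \<R> - {R1}" "Rr \<notin> \<R> - {R1}" "Rl \<noteq> Rr"
    using disj[of Rl] disj[of Rr] s un dis by auto
  have count: "card (A - {R1} \<union> {Rl, Rr}) = card A + 1" if "R1 \<in> A" "A \<subseteq> \<R>" for A
  proof -
    have "finite A" using that fin finite_subset by blast
    moreover have "card A > 0" using that \<open>finite A\<close> by (auto simp: card_gt_0_iff)
    moreover have "Rl \<notin> A - {R1}" "Rr \<notin> A - {R1}" using new that by auto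
    ultimately show ?thesis using new that by (simp add: card_Diff_singleton)
  qed
  show "card \<R>' = card \<R> + 1" using count[of \<R>] R1' R' by simp
  have "x \<notin> scenario_Inter Xs Rl" "x \<notin> scenario_Inter Xs Rr"
    using x s by (auto simp: scenario_Inter_def)
  then have "infeasible_subsets Xs \<R>' x = infeasible_subsets Xs \<R> x - {R1} \<union> {Rl, Rr}"
    unfolding R' by (auto simp: infeasible_subsets_def)
  then show "card (infeasible_subsets Xs \<R>' x) = card (infeasible_subsets Xs \<R> x) + 1"
    using count[of "infeasible_subsets Xs \<R> x"] R1 by (simp add: infeasible_subsets_def)
qed

text \<open>The loop stops at exactly \<open>N\<close> parts, without overshooting, because every pass adds one
  part. The hypothesis \<open>card \<A> \<le> N\<close> excludes a start that already has too many parts.\<close>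

lemma refinement_loop_card:
  assumes "refinement_loop S Xs x N \<A> \<R>" "finite S" "partition_on S \<A>" "int (card \<A>) \<le> N"
  shows "int (card \<R>) = N \<and>
    int (card (infeasible_subsets Xs \<R> x))
      = int (card (infeasible_subsets Xs \<A> x)) + N - int (card \<A>)"
  using assms
proof (induction rule: refinement_loop.induct)
  case (exit \<A>)
  then show ?case by simp
next
  case (iterate \<A> \<A>' \<R>)
  have "partition_on S \<A>'"
    using refinement_step_refines[OF iterate.prems(2) iterate.hyps(2)] by (simp add: refines_def)
  then show ?case
    using iterate.IH iterate.hyps(1) iterate.prems(1)
      refinement_step_card[OF iterate.prems(1,2) iterate.hyps(2)]
    by simp
qed

text \<open>The parts of \<open>\<P>\<close> violated by \<open>y\<close> are at most those shared with \<open>\<R>\<close> together with all of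
  \<open>\<P> - \<R>\<close>, and \<open>\<P> - \<R>\<close> is smaller than \<open>\<R> - \<P>\<close> by \<open>|\<R>| - |\<P>|\<close>.\<close>

lemma card_infeasible_subsets_coarse_le:
  assumes fin: "finite \<P>" "finite \<R>"
    and viol: "\<And>R. R \<in> \<R> - \<P> \<Longrightarrow> y \<notin> scenario_Inter Xs R"
  shows "card (infeasible_subsets Xs \<P> y) + card \<R> \<le> card (infeasible_subsets Xs \<R> y) + card \<P>"
proof -
  let ?C = "infeasible_subsets Xs (\<P> \<inter> \<R>) y"
  have finC: "finite ?C" using fin by (simp add: infeasible_subsets_def)
  have "infeasible_subsets Xs \<P> y \<subseteq> ?C \<union> (\<P> - \<R>)"
    by (auto simp: infeasible_subsets_def)
  then have "card (infeasible_subsets Xs \<P> y) \<le> card (?C \<union> (\<P> - \<R>))"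
    using finC fin by (intro card_mono) auto
  also have "\<dots> \<le> card ?C + card (\<P> - \<R>)" by (rule card_Un_le)
  finally have 1: "card (infeasible_subsets Xs \<P> y) \<le> card ?C + card (\<P> - \<R>)" .
  have "infeasible_subsets Xs \<R> y = ?C \<union> (\<R> - \<P>)"
    using viol by (auto simp: infeasible_subsets_def)
  moreover have "?C \<inter> (\<R> - \<P>) = {}" by (auto simp: infeasible_subsets_def)
  ultimately have 2: "card (infeasible_subsets Xs \<R> y) = card ?C + card (\<R> - \<P>)"
    using finC fin by (simp add: card_Un_disjoint)
  have "card \<P> = card (\<P> \<inter> \<R>) + card (\<P> - \<R>)" "card \<R> = card (\<P> \<inter> \<R>) + card (\<R> - \<P>)"
    using fin card_Int_Diff[of \<P> \<R>] card_Int_Diff[of \<R> \<P>] by (simp_all add: Int_commute)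
  with 1 2 show ?thesis by simp
qed

section \<open>Counting along the merger\<close>

lemma Union_notin_partition_Diff:
  assumes "partition_on S \<R>" "\<T> \<subseteq> \<R>" "\<T> \<noteq> {}"
  shows "\<Union>\<T> \<notin> \<R> - \<T>"
proof
  assume U: "\<Union>\<T> \<in> \<R> - \<T>"
  obtain T where T: "T \<in> \<T>" using assms(3) by blast
  then have "T \<in> \<R>" "T \<noteq> \<Union>\<T>" "T \<noteq> {}" using assms(1,2) U by (auto simp: partition_on_def)
  then have "T \<inter> \<Union>\<T> = {}" using assms(1) U by (metis DiffD1 disjointD partition_onD2)
  then show False using T \<open>T \<noteq> {}\<close> by blast
qed

lemma card_merge:
  assumes "finite \<R>" "partition_on S \<R>" "\<T> \<subseteq> \<R>" "\<T> \<noteq> {}"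
  shows "card (insert (\<Union>\<T>) (\<R> - \<T>)) + card \<T> = card \<R> + 1"
proof -
  have "finite \<T>" using assms(1,3) finite_subset by blast
  moreover have "card \<T> \<le> card \<R>" using assms(1,3) by (rule card_mono)
  ultimately show ?thesis
    using assms(1,3) Union_notin_partition_Diff[OF assms(2-4)] by (simp add: card_Diff_subset)
qed

text \<open>The union of \<open>\<T>\<close> is violated as soon as one member of \<open>\<T>\<close> is, so the violated members of
  \<open>\<T>\<close>, if there are any, are replaced by a single violated part.\<close>

lemma card_infeasible_subsets_merge:
  assumes "finite \<R>" "partition_on S \<R>" "\<T> \<subseteq> \<R>" "\<T> \<noteq> {}"
  shows "card (infeasible_subsets Xs (insert (\<Union>\<T>) (\<R> - \<T>)) y) + card (infeasible_subsets Xs \<T> y)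
    = card (infeasible_subsets Xs \<R> y) + of_bool (infeasible_subsets Xs \<T> y \<noteq> {})"
proof -
  let ?rest = "infeasible_subsets Xs (\<R> - \<T>) y" and ?t = "infeasible_subsets Xs \<T> y"
  have fin: "finite ?rest" "finite ?t"
    using assms(1) finite_subset[OF assms(3,1)] by (auto simp: infeasible_subsets_def)
  have "infeasible_subsets Xs \<R> y = ?rest \<union> ?t" "?rest \<inter> ?t = {}"
    using assms(3) by (auto simp: infeasible_subsets_def)
  then have split: "card (infeasible_subsets Xs \<R> y) = card ?rest + card ?t"
    using fin by (simp add: card_Un_disjoint)
  have "infeasible_subsets Xs (insert (\<Union>\<T>) (\<R> - \<T>)) y
      = (if ?t \<noteq> {} then insert (\<Union>\<T>) ?rest else ?rest)"
    by (auto simp: infeasible_subsets_def scenario_Inter_def)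
  moreover have "\<Union>\<T> \<notin> ?rest"
    using Union_notin_partition_Diff[OF assms(2-4)] by (simp add: infeasible_subsets_def)
  ultimately have "card (infeasible_subsets Xs (insert (\<Union>\<T>) (\<R> - \<T>)) y)
      = card ?rest + of_bool (?t \<noteq> {})"
    using fin by simp
  with split show ?thesis by simp
qed

text \<open>Both ways of selecting join \<open>\<mu> + 1\<close> parts of which \<open>x\<close> violates at most one. In the case
  \<open>|\<P>| = K + 1\<close> the selected violated part cannot be one of the \<open>\<mu>\<close> satisfied ones, so it adds to
  their number.\<close>

lemma maximal_size_merger_selection:
  assumes "maximal_size_merger S \<tau> Xs \<P> \<R> x \<M>" "finite \<R>"
    and \<mu>: "refine_count S \<tau> Xs \<P> x \<ge> 0"
  obtains \<T> where "\<T> \<subseteq> \<R>" "int (card \<T>) = refine_count S \<tau> Xs \<P> x + 1"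
    "card (infeasible_subsets Xs \<T> x) \<le> 1" "\<M> = insert (\<Union>\<T>) (\<R> - \<T>)"
proof -
  obtain \<T> where sel: "if int (card \<P>) = \<lfloor>\<tau> * real (card S)\<rfloor> + 1
            then \<exists>\<F> M. \<F> \<subseteq> feasible_subsets Xs \<R> x \<and>
                   int (card \<F>) = refine_count S \<tau> Xs \<P> x \<and>
                   M \<in> infeasible_subsets Xs \<R> x \<and> \<T> = insert M \<F>
            else \<T> \<subseteq> feasible_subsets Xs \<R> x \<and>
                   int (card \<T>) = refine_count S \<tau> Xs \<P> x + 1"
    and M: "\<M> = insert (\<Union>\<T>) (\<R> - \<T>)"
    using assms(1) unfolding maximal_size_merger_def by (elim exE conjE)
  have "\<T> \<subseteq> \<R> \<and> int (card \<T>) = refine_count S \<tau> Xs \<P> x + 1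
    \<and> card (infeasible_subsets Xs \<T> x) \<le> 1"
  proof (cases "int (card \<P>) = \<lfloor>\<tau> * real (card S)\<rfloor> + 1")
    case True
    then obtain \<F> M where F: "\<F> \<subseteq> feasible_subsets Xs \<R> x"
      "int (card \<F>) = refine_count S \<tau> Xs \<P> x" "M \<in> infeasible_subsets Xs \<R> x"
      "\<T> = insert M \<F>"
      using sel by auto
    have "finite \<F>" using F(1) assms(2) by (auto simp: feasible_subsets_def intro: finite_subset)
    moreover have "M \<notin> \<F>"
      using F(1,3) by (auto simp: feasible_subsets_def infeasible_subsets_def)
    moreover have "infeasible_subsets Xs \<T> x = {M}"
      using F by (auto simp: feasible_subsets_def infeasible_subsets_def)
    ultimately show ?thesis
      using F by (auto simp: feasible_subsets_def infeasible_subsets_def)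
  next
    case False
    with sel have F: "\<T> \<subseteq> feasible_subsets Xs \<R> x"
      "int (card \<T>) = refine_count S \<tau> Xs \<P> x + 1" by auto
    then have "infeasible_subsets Xs \<T> x = {}"
      by (auto simp: feasible_subsets_def infeasible_subsets_def)
    with F show ?thesis by (auto simp: feasible_subsets_def)
  qed
  with M that show thesis by blast
qed

section \<open>Size and value of the merger\<close>

lemma opt_value_eq_arg_min:
  assumes "is_arg_min f (\<lambda>y. y \<in> F) x"
  shows "opt_value f F = ereal (f x)"
proof -
  have "f x \<le> f y" if "y \<in> F" for y using assms that by (auto simp: is_arg_min_linorder)
  moreover have "x \<in> F" using assms by (simp add: is_arg_min_linorder)
  ultimately show ?thesis
    unfolding opt_value_def by (intro antisym INF_greatest INF_lower) auto
qed

lemma opt_value_greater_if_attained: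
  assumes "attains_min f F" and "\<And>y. y \<in> F \<Longrightarrow> c < f y"
  shows "ereal c < opt_value f F"
proof (cases "F = {}")
  case True
  then show ?thesis by (simp add: opt_value_def top_ereal_def)
next
  case False
  then obtain y where "is_arg_min f (\<lambda>y. y \<in> F) y"
    using assms(1) by (auto simp: attains_min_def)
  then show ?thesis
    using assms(2)[of y] opt_value_eq_arg_min[of f F y] by (simp add: is_arg_min_linorder)
qed

theorem theorem2:
  fixes S :: "'s set" and p :: "'s \<Rightarrow> real" and \<tau> :: real
    and D :: "(real ^ 'n) set" and f :: "real ^ 'n \<Rightarrow> real" and Xs :: "'s \<Rightarrow> (real ^ 'n) set"
    and \<P> \<R> \<M> :: "'s set set" and x :: "real ^ 'n"
  assumes "finite S" and "S \<noteq> {}"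
    and "0 \<le> \<tau>" and "\<tau> \<le> 1"
    and "\<And>s. s \<in> S \<Longrightarrow> p s = 1 / real (card S)"
    and "attains_min f (original_feasible S p \<tau> D Xs)"
    and "\<And>\<A>. partition_on S \<A> \<Longrightarrow> attains_min f (partitioned_feasible p \<tau> D Xs \<A>)"
    and "\<And>P. P \<subseteq> S \<Longrightarrow> P \<noteq> {} \<Longrightarrow> attains_min f (scenario_Inter Xs P \<inter> D)"
    and "partition_on S \<P>"
    and "int (card \<P>) > \<lfloor>\<tau> * real (card S)\<rfloor>"
    and "is_arg_min f (\<lambda>y. y \<in> partitioned_feasible p \<tau> D Xs \<P>) x"
    and "minimal_size_refinement S \<tau> Xs \<P> x \<R>"
    and "Min (subset_cost D f Xs ` (\<R> - \<P>)) > partitioned_value p \<tau> D f Xs \<P>"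
    and "\<And>y. is_arg_min f (\<lambda>z. z \<in> partitioned_feasible p \<tau> D Xs \<P>) y \<Longrightarrow> y = x"
    and "x \<notin> original_feasible S p \<tau> D Xs"
    and "maximal_size_merger S \<tau> Xs \<P> \<R> x \<M>"
  shows "card \<M> = card \<P> \<and> partitioned_value p \<tau> D f Xs \<M> > partitioned_value p \<tau> D f Xs \<P>"
proof -
  let ?K = "\<lfloor>\<tau> * real (card S)\<rfloor>" and ?\<mu> = "refine_count S \<tau> Xs \<P> x"
  let ?I = "infeasible_subsets Xs"
  have feas_iff: "y \<in> partitioned_feasible p \<tau> D Xs \<A> \<longleftrightarrow> y \<in> D \<and> int (card (?I \<A> y)) \<le> ?K"
    if "partition_on S \<A>" for \<A> y
    by (rule mem_partitioned_feasible_iff[OF assms(1,2) _ that]) (rule assms(5))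
  have part: "partition_on S \<P>" by fact
  have partR: "partition_on S \<R>"
    using minimal_size_refinement_refines[OF part assms(12)] by (simp add: refines_def)
  have finP: "finite \<P>" and finR: "finite \<R>"
    using finite_partition[OF assms(1)] part partR by auto
  have xP: "x \<in> partitioned_feasible p \<tau> D Xs \<P>"
    using assms(11) by (simp add: is_arg_min_linorder)
  have vP: "partitioned_value p \<tau> D f Xs \<P> = ereal (f x)"
    using opt_value_eq_arg_min[OF assms(11)] by (simp add: partitioned_value_def)
  have \<mu>: "?\<mu> \<ge> 1"
    using xP feas_iff[OF part] by (simp add: refine_count_def)
  have cardR: "int (card \<R>) = int (card \<P>) + ?\<mu>" and cardI: "int (card (?I \<R> x)) = ?K + 1"
    using refinement_loop_card[OF assms(12)[unfolded minimal_size_refinement_def] assms(1) part] \<mu>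
    by (simp_all add: refine_count_def)

  obtain \<T> where T: "\<T> \<subseteq> \<R>" "int (card \<T>) = ?\<mu> + 1" "card (?I \<T> x) \<le> 1"
    and M: "\<M> = insert (\<Union>\<T>) (\<R> - \<T>)"
    using maximal_size_merger_selection[OF assms(16) finR] \<mu> by auto
  have Tne: "\<T> \<noteq> {}" using T(2) \<mu> by auto
  have finT: "finite \<T>" using T(1) finR finite_subset by blast
  have partM: "partition_on S \<M>"
    using maximal_size_merger_refines[OF partR assms(16)] \<mu> by (simp add: refines_def)
  have cardM: "card \<M> = card \<P>"
    using card_merge[OF finR partR T(1) Tne] T(2) cardR by (simp add: M)
  have merge: "card (?I \<M> y) + card (?I \<T> y) = card (?I \<R> y) + of_bool (?I \<T> y \<noteq> {})" for y
    unfolding M using card_infeasible_subsets_merge[OF finR partR T(1) Tne] .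

  have xM: "x \<notin> partitioned_feasible p \<tau> D Xs \<M>"
  proof -
    have "finite (?I \<T> x)" using finT by (simp add: infeasible_subsets_def)
    then have "card (?I \<T> x) \<le> of_bool (?I \<T> x \<noteq> {})" using T(3) by (cases "?I \<T> x = {}") simp_all
    then have "card (?I \<R> x) \<le> card (?I \<M> x)" using merge[of x] by linarith
    then show ?thesis using cardI feas_iff[OF partM] by simp
  qed

  \<comment> \<open>Being feasible for \<open>\<M>\<close> is compared with \<open>\<P>\<close> itself when no new part of \<open>\<R>\<close> is satisfied,
      and paid for by the cost of a new part otherwise.\<close>
  have "f x < f y" if y: "y \<in> partitioned_feasible p \<tau> D Xs \<M>" for y
  proof (cases "\<exists>R \<in> \<R> - \<P>. y \<in> scenario_Inter Xs R")
    case True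
    then obtain R where R: "R \<in> \<R> - \<P>" "y \<in> scenario_Inter Xs R" by blast
    have "y \<in> D" using y by (simp add: partitioned_feasible_def)
    have "ereal (f x) < Min (subset_cost D f Xs ` (\<R> - \<P>))" using assms(13) vP by simp
    also have "\<dots> \<le> subset_cost D f Xs R" using R finR by (intro Min_le) auto
    also have "\<dots> \<le> ereal (f y)"
      unfolding subset_cost_def opt_value_def using R \<open>y \<in> D\<close> by (intro INF_lower) auto
    finally show ?thesis by simp
  next
    case False
    have "card (?I \<T> y) \<le> card \<T>"
      using finT by (intro card_mono) (auto simp: infeasible_subsets_def)
    then have "int (card (?I \<R> y)) \<le> int (card (?I \<M> y)) + ?\<mu>"
      using merge[of y] T(2) \<mu> by (cases "?I \<T> y = {}") simp_all
    moreover have "card (?I \<P> y) + card \<R> \<le> card (?I \<R> y) + card \<P>"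
      by (rule card_infeasible_subsets_coarse_le[OF finP finR]) (use False in blast)
    ultimately have "int (card (?I \<P> y)) \<le> int (card (?I \<M> y))"
      using cardR by linarith
    then have yP: "y \<in> partitioned_feasible p \<tau> D Xs \<P>"
      using y unfolding feas_iff[OF part] feas_iff[OF partM] by linarith
    show ?thesis
    proof (rule ccontr)
      assume "\<not> f x < f y"
      then have "is_arg_min f (\<lambda>z. z \<in> partitioned_feasible p \<tau> D Xs \<P>) y"
        using assms(11) yP unfolding is_arg_min_linorder by (meson linorder_not_less order_trans)
      then have "y = x" by (rule assms(14))
      then show False using y xM by simp
    qed
  qed
  then have "ereal (f x) < partitioned_value p \<tau> D f Xs \<M>"
    unfolding partitioned_value_def
    using opt_value_greater_if_attained[OF assms(7)[OF partM]] by blast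
  then show ?thesis using cardM vP by simp
qed

end
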